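(* Let $T(x)=x(1+V(x))\bmod 1$ be a map in the family $\mathscr F$, and suppose that $\omega,\Omega\in\mathcal M$ satisfy $$\liminf_{x\to0}\frac{V(x)}{\omega(x)}\Big(\Omega\big((1+c)x\big)-\Omega(x)\Big)>0$$ for every sufficiently small $c>0$. Then $\Omega$ is $T$-compatible with respect to $\omega$.
   Context: $\mathbb T=\mathbb R/\mathbb Z=[0,1)$ is the circle with metric $d(x,y)=\min\{|x-y|,|x-y\pm1|\}$. Family $\mathscr F$: all continuous maps $T:\mathbb T\to\mathbb T$ of the form $T(x)=x(1+V(x))\bmod 1$ for $x\in[0,1)$, where $V:[0,+\infty)\to[0,+\infty)$ is continuous and increasing, $V(0)=0$ (so $0$ is an indifferent fixed point), $V(1)$ is a positive integer, and for some $\sigma\ge0$ one has $\lim_{x\to0}V(tx)/V(x)=t^\sigma$ for all $t>0$. $\mathcal M$ is the set of all concave moduli of continuity, i.e. concave, continuous, non-decreasing functions $\omega:[0,+\infty)\to[0,+\infty)$ with $\omega(0)=0$. $T$-compatibility: for $T\in\mathscr F$ and $\omega,\Omega\in\mathcal M$, $\Omega$ is $T$-compatible with respect to $\omega$ if there are constants $\varrho_1>0$ and $C_1>0$ such that, given any sequence $\{x_k\}_{k\ge0}$ in $\mathbb T$ with $T(x_{k+1})=x_k$ for $k\ge0$, and a point $y_0\in\mathbb T$ with $d(x_0,y_0)<\varrho_1$, there is a unique pre-orbit $\{y_k\}_{k\ge1}$ of $y_0$ (that is, $T(y_{k+1})=y_k$ for $k\ge0$) satisfying, for all $k\ge1$,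 $$d(x_k,y_k)\le d(x_0,y_0)<\varrho_1\quad\text{and}\quad \Omega(d(x_k,y_k))+C_1\sum_{j=1}^k\omega(d(x_j,y_j))\le\Omega(d(x_0,y_0));$$ moreover, this correspondence between pre-orbits of $x_0$ and pre-orbits of $y_0$ is one-to-one. *)

theory Defs
  imports "HOL-Analysis.Analysis"
begin

text \<open>The circle \<open>\<real>/\<int>\<close> is represented by the fundamental domain \<open>[0,1)\<close>.\<close>

definition circle :: "real set" where
  "circle = {0..<1}"

definition circle_dist :: "real \<Rightarrow> real \<Rightarrow> real" where
  "circle_dist x y = Min {\<bar>x - y\<bar>, \<bar>x - y + 1\<bar>, \<bar>x - y - 1\<bar>}"

interpretation circle: Metric_space circle circle_dist
proof
  fix x y z :: real
  show "0 \<le> circle_dist x y"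
    by (simp add: circle_dist_def)
  show "circle_dist x y = circle_dist y x"
    by (simp add: circle_dist_def) linarith
  show "circle_dist x y = 0 \<longleftrightarrow> x = y" if "x \<in> circle" "y \<in> circle"
    using that by (auto simp: circle_dist_def circle_def min_def abs_if)
  show "circle_dist x z \<le> circle_dist x y + circle_dist y z"
    if "x \<in> circle" "y \<in> circle" "z \<in> circle"
    using that by (simp add: circle_dist_def circle_def) linarith
qed

text \<open>Only the restrictions of \<open>V\<close> to \<open>[0,\<infinity>)\<close> and of \<open>T\<close> to \<open>[0,1)\<close> are constrained.
  Continuity of \<open>T\<close> is implied by the other conditions, since \<open>V 1\<close> is an integer.\<close>

definition in_family :: "(real \<Rightarrow> real) \<Rightarrow> (real \<Rightarrow> real) \<Rightarrow> bool" where
  "in_family T V \<longleftrightarrow>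
     (\<forall>x\<ge>0. V x \<ge> 0) \<and>
     continuous_on {0..} V \<and>
     strict_mono_on {0..} V \<and>
     V 0 = 0 \<and>
     (\<exists>m::nat. m > 0 \<and> V 1 = real m) \<and>
     (\<exists>\<sigma>\<ge>0. \<forall>t>0. ((\<lambda>x. V (t * x) / V x) \<longlongrightarrow> t powr \<sigma>) (at_right 0)) \<and>
     (\<forall>x\<in>circle. T x = frac (x * (1 + V x))) \<and>
     continuous_map circle.mtopology circle.mtopology T"

definition concave_moduli :: "(real \<Rightarrow> real) set" where
  "concave_moduli = {\<omega>. (\<forall>x\<ge>0. \<omega> x \<ge> 0) \<and> concave_on {0..} \<omega> \<and>
     continuous_on {0..} \<omega> \<and> mono_on {0..} \<omega> \<and> \<omega> 0 = 0}"

text \<open>A pre-orbit of \<open>p\<close> is stored together with \<open>p\<close> itself as its term of index \<open>0\<close>.\<close>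

definition preorbits :: "(real \<Rightarrow> real) \<Rightarrow> real \<Rightarrow> (nat \<Rightarrow> real) set" where
  "preorbits T p = {x. x 0 = p \<and> (\<forall>k. x k \<in> circle) \<and> (\<forall>k. T (x (Suc k)) = x k)}"

definition controlled ::
  "(real \<Rightarrow> real) \<Rightarrow> (real \<Rightarrow> real) \<Rightarrow> real \<Rightarrow> real \<Rightarrow> (nat \<Rightarrow> real) \<Rightarrow> (nat \<Rightarrow> real) \<Rightarrow> bool"
where
  "controlled \<omega> \<Omega> \<rho> C x y \<longleftrightarrow> (\<forall>k\<ge>1.
     circle_dist (x k) (y k) \<le> circle_dist (x 0) (y 0) \<and> circle_dist (x 0) (y 0) < \<rho> \<and>
     \<Omega> (circle_dist (x k) (y k)) + C * (\<Sum>j=1..k. \<omega> (circle_dist (x j) (y j)))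
       \<le> \<Omega> (circle_dist (x 0) (y 0)))"

text \<open>The final \<open>bij_betw\<close> clause says that the assignment \<open>x \<mapsto> y\<close>, well defined by the
  preceding clause, is a one-to-one correspondence between pre-orbits.\<close>

definition compatible :: "(real \<Rightarrow> real) \<Rightarrow> (real \<Rightarrow> real) \<Rightarrow> (real \<Rightarrow> real) \<Rightarrow> bool" where
  "compatible T \<omega> \<Omega> \<longleftrightarrow> (\<exists>\<rho>>0. \<exists>C>0. \<forall>p\<in>circle. \<forall>q\<in>circle. circle_dist p q < \<rho> \<longrightarrow>
     (\<forall>x\<in>preorbits T p. \<exists>!y. y \<in> preorbits T q \<and> controlled \<omega> \<Omega> \<rho> C x y) \<and>
     bij_betw (\<lambda>x. THE y. y \<in> preorbits T q \<and> controlled \<omega> \<Omega> \<rho> C x y)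
       (preorbits T p) (preorbits T q))"

end

theory Submission
  imports Defs
begin

text \<open>
  Write \<open>F x = x * (1 + V x)\<close>, so that \<open>T\<close> is \<open>F\<close> modulo \<open>1\<close>.  Since \<open>V\<close> increases, \<open>F\<close> expands
  distances, and even near the indifferent fixed point the factor is bounded below in terms of the
  distance alone: if \<open>y\<close> is the preimage of \<open>q\<close> obtained by following the inverse branch of \<open>T\<close>
  through \<open>x\<close>, and \<open>h\<close> is the distance between \<open>x\<close> and \<open>y\<close>, then the distance between \<open>T x\<close> and \<open>q\<close>
  is at least \<open>h * (1 + V (h / 2) / 2)\<close> (lemma \<open>inverse_branch_expansion\<close>).  The factors \<open>1/2\<close> pay
  for arcs that straddle the fixed point, where \<open>h\<close> splits into two pieces, the longer of which has
  length at least \<open>h / 2\<close>.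

  The hypothesis turns this gain in distance into a gain for \<open>\<Omega>\<close>.  It compares \<open>\<Omega> ((1 + c) * h) - \<Omega> h\<close>
  with \<open>\<omega> h / V h\<close> for one fixed \<open>c\<close>; by concavity the increment of \<open>\<Omega>\<close> over the shorter interval
  from \<open>h\<close> to \<open>h * (1 + V (h / 2) / 2)\<close> is at least the proportional part \<open>V (h / 2) / (2 * c)\<close>
  of it, and regular variation of \<open>V\<close> bounds \<open>V (h / 2) / V h\<close> from below.  Hence each backward step
  with \<open>h\<close> small satisfies \<open>\<Omega> h + C * \<omega> h \<le> \<Omega> u\<close>, where \<open>u\<close> is the distance before the step (lemma
  \<open>modulus_gain\<close>), and the required inequality is the sum of these over the steps.

  Uniqueness follows from the injectivity of \<open>T\<close> at small scale (lemma \<open>locally_injective\<close>).  As the control condition is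
  symmetric in the two pre-orbits, exchanging the roles of the base points gives the inverse
  correspondence.
\<close>

section \<open>The lift of the map to an interval\<close>

definition lift :: "(real \<Rightarrow> real) \<Rightarrow> real \<Rightarrow> real" where
  "lift V x = x * (1 + V x)"

lemma in_family_nonneg: "in_family T V \<Longrightarrow> 0 \<le> x \<Longrightarrow> 0 \<le> V x"
  by (simp add: in_family_def)

lemma in_family_mono:
  assumes "in_family T V" "0 \<le> x" "x \<le> y"
  shows "V x \<le> V y"
proof -
  have "strict_mono_on {0..} V"
    using assms(1) by (simp add: in_family_def)
  then show ?thesis
    using assms(2,3) strict_mono_on_leD[of "{0..}" V x y] by simp
qed

lemma in_family_pos:
  assumes "in_family T V" "0 < x"
  shows "0 < V x"
proof -
  have "strict_mono_on {0..} V" "V 0 = 0"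
    using assms(1) by (auto simp: in_family_def)
  then show ?thesis
    using strict_mono_onD[of "{0..}" V 0 x] assms(2) by auto
qed

lemma in_family_eq_frac_lift: "in_family T V \<Longrightarrow> x \<in> circle \<Longrightarrow> T x = frac (lift V x)"
  by (simp add: in_family_def lift_def)

lemma lift_zero [simp]: "lift V 0 = 0"
  by (simp add: lift_def)

lemma lift_one:
  assumes "in_family T V"
  obtains D :: int where "D \<ge> 1" "lift V 1 = of_int D"
proof -
  obtain m :: nat where "m > 0" "V 1 = real m"
    using assms by (auto simp: in_family_def)
  then show ?thesis
    by (intro that[of "1 + int m"]) (auto simp: lift_def)
qed

lemma continuous_on_lift:
  assumes "in_family T V"
  shows "continuous_on {0..1} (lift V)"
proof -
  have "continuous_on {0..1} V"
    using assms by (auto simp: in_family_def intro: continuous_on_subset)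
  then show ?thesis
    unfolding lift_def by (intro continuous_intros)
qed

lemma lift_expanding:
  assumes "in_family T V" "0 \<le> x" "x \<le> y"
  shows "(y - x) * (1 + V y) \<le> lift V y - lift V x"
proof -
  have "x * V x \<le> x * V y"
    using in_family_mono[OF assms] assms(2) by (rule mult_left_mono)
  then show ?thesis
    by (simp add: lift_def algebra_simps)
qed

lemma lift_strict_mono:
  assumes "in_family T V" "0 \<le> x" "x < y"
  shows "lift V x < lift V y"
proof -
  have "0 < (y - x) * (1 + V y)"
    using assms in_family_nonneg[OF assms(1), of y] by (intro mult_pos_pos) auto
  then show ?thesis
    using lift_expanding[of T V x y] assms by simp
qed

lemma lift_nonneg: "in_family T V \<Longrightarrow> 0 \<le> x \<Longrightarrow> 0 \<le> lift V x"
  using in_family_nonneg[of T V x] by (simp add: lift_def)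

lemma lift_surj_on_circle:
  assumes "in_family T V" "0 \<le> w" "w < lift V 1"
  obtains y where "y \<in> circle" "lift V y = w"
proof -
  obtain y where y: "0 \<le> y" "y \<le> 1" "lift V y = w"
    using IVT'[of "lift V" 0 w 1] continuous_on_lift[OF assms(1)] assms by auto
  then have "y \<noteq> 1"
    using assms(3) by auto
  with y show ?thesis
    by (intro that[of y]) (auto simp: circle_def)
qed

section \<open>Distances on the circle\<close>

lemma circle_dist_commute: "circle_dist x y = circle_dist y x"
  by (rule circle.commute)

lemma circle_dist_shift:
  obtains n :: int where "circle_dist p q = \<bar>q - p + of_int n\<bar>"
proof -
  have "circle_dist p q \<in> {\<bar>p - q\<bar>, \<bar>p - q + 1\<bar>, \<bar>p - q - 1\<bar>}"
    unfolding circle_dist_def by (rule Min_in) auto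
  then consider "circle_dist p q = \<bar>p - q\<bar>" | "circle_dist p q = \<bar>p - q + 1\<bar>"
    | "circle_dist p q = \<bar>p - q - 1\<bar>"
    by auto
  then show ?thesis
  proof cases
    case 1 then show ?thesis by (intro that[of 0]) auto
  next
    case 2 then show ?thesis by (intro that[of "-1"]) auto
  next
    case 3 then show ?thesis by (intro that[of 1]) auto
  qed
qed

lemma circle_dist_le:
  "circle_dist x y \<le> \<bar>x - y\<bar>" "circle_dist x y \<le> \<bar>x - y + 1\<bar>" "circle_dist x y \<le> \<bar>x - y - 1\<bar>"
proof -
  have eq: "circle_dist x y = min \<bar>x - y\<bar> (min \<bar>x - y + 1\<bar> \<bar>x - y - 1\<bar>)"
    by (simp add: circle_dist_def)
  show "circle_dist x y \<le> \<bar>x - y\<bar>"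
    unfolding eq by (rule min.cobounded1)
  show "circle_dist x y \<le> \<bar>x - y + 1\<bar>"
    unfolding eq by (rule min.coboundedI2[OF min.cobounded1])
  show "circle_dist x y \<le> \<bar>x - y - 1\<bar>"
    unfolding eq by (rule min.coboundedI2[OF min.cobounded2])
qed

text \<open>
  The two arcs between points \<open>x \<le> y\<close> of \<open>[0,1)\<close> are treated separately: the first part is the arc
  inside the interval; the second is the complementary arc through the fixed point, cut there into
  pieces of length \<open>x\<close> and \<open>1 - y\<close>.
\<close>

lemma lift_arc_expansion:
  assumes T: "in_family T V" and x: "0 \<le> x" "x \<le> y" and y: "y \<le> 1"
  defines "h \<equiv> circle_dist x y"
  shows "h * (1 + V (h / 2) / 2) \<le> lift V y - lift V x"
    and "h * (1 + V (h / 2) / 2) \<le> lift V x + lift V 1 - lift V y"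
proof -
  have h: "0 \<le> h" "h \<le> y - x" "h \<le> x + (1 - y)"
    unfolding h_def using circle_dist_le[of x y] x y by auto
  have Vh: "0 \<le> V (h / 2)"
    using in_family_nonneg[OF T] h by simp
  have "V (h / 2) \<le> V y"
    using in_family_mono[OF T, of "h / 2" y] h x by simp
  then have "h * (1 + V (h / 2) / 2) \<le> (y - x) * (1 + V y)"
    using h x Vh by (intro mult_mono) auto
  also have "\<dots> \<le> lift V y - lift V x"
    by (rule lift_expanding[OF T x])
  finally show "h * (1 + V (h / 2) / 2) \<le> lift V y - lift V x" .
  have "h / 2 * V (h / 2) \<le> x * V x + (1 - y) * V 1"
  proof (cases "h / 2 \<le> x")
    case True
    then have "h / 2 * V (h / 2) \<le> x * V x"
      using in_family_mono[OF T, of "h / 2" x] h Vh by (intro mult_mono) auto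
    moreover have "0 \<le> (1 - y) * V 1"
      using y in_family_nonneg[OF T, of 1] by simp
    ultimately show ?thesis by simp
  next
    case False
    then have "h / 2 * V (h / 2) \<le> (1 - y) * V 1"
      using in_family_mono[OF T, of "h / 2" 1] h x y Vh by (intro mult_mono) auto
    moreover have "0 \<le> x * V x"
      using x in_family_nonneg[OF T, of x] by simp
    ultimately show ?thesis by simp
  qed
  moreover have "(1 - y) * (1 + V 1) \<le> lift V 1 - lift V y"
    using lift_expanding[OF T, of y 1] x y by simp
  ultimately show "h * (1 + V (h / 2) / 2) \<le> lift V x + lift V 1 - lift V y"
    using h by (simp add: lift_def algebra_simps)
qed

section \<open>Inverse branches and injectivity at small scale\<close>

text \<open>
  The preimage is found by moving from \<open>lift V x\<close> by the signed displacement from \<open>T x\<close> to \<open>q\<close>; if this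
  leaves \<open>[0, lift V 1)\<close>, it is brought back by the period \<open>lift V 1\<close>, which means that the arc from
  \<open>x\<close> to the preimage passes through the fixed point.
\<close>

lemma inverse_branch_expansion:
  assumes T: "in_family T V" and x: "x \<in> circle" and q: "q \<in> circle"
  obtains y where "y \<in> circle" "T y = q"
    "circle_dist x y * (1 + V (circle_dist x y / 2) / 2) \<le> circle_dist (T x) q"
proof -
  obtain D where D: "D \<ge> 1" "lift V 1 = of_int D"
    by (rule lift_one[OF T])
  have Tx: "T x = frac (lift V x)"
    by (rule in_family_eq_frac_lift[OF T x])
  obtain n where n: "circle_dist (T x) q = \<bar>q - T x + of_int n\<bar>"
    by (rule circle_dist_shift)
  define s where "s = q - T x + of_int n"
  define w where "w = lift V x + s"
  have "circle_dist (T x) q < 1"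
    using circle_dist_le(1)[of "T x" q] q frac_ge_0[of "lift V x"] frac_lt_1[of "lift V x"]
    by (simp only: Tx circle_def atLeastLessThan_iff) linarith
  then have s1: "\<bar>s\<bar> < 1" and d: "circle_dist (T x) q = \<bar>s\<bar>"
    using n by (auto simp: s_def)
  have x01: "0 \<le> x" "x < 1"
    using x by (auto simp: circle_def)
  have Fx: "0 \<le> lift V x" "lift V x < of_int D"
    using lift_nonneg[OF T, of x] lift_strict_mono[OF T, of x 1] x01 D by auto
  have w: "w = q + of_int (\<lfloor>lift V x\<rfloor> + n)"
    by (simp add: w_def s_def Tx frac_def)
  have preimage: "T y = q" if "y \<in> circle" "lift V y = w + of_int k" for y k
  proof -
    have "frac (lift V y) = q"
      using that(2) w q by (simp add: frac_unique_iff circle_def)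
    then show ?thesis
      using in_family_eq_frac_lift[OF T that(1)] by simp
  qed
  consider "w < 0" | "0 \<le> w" "w < of_int D" | "of_int D \<le> w"
    by linarith
  then show ?thesis
  proof cases
    case 1
    then obtain y where y: "y \<in> circle" "lift V y = w + of_int D"
      using lift_surj_on_circle[OF T, of "w + of_int D"] s1 Fx D by (auto simp: w_def)
    have "lift V x \<le> lift V y"
      using y s1 D by (simp add: w_def)
    then have "x \<le> y"
      using lift_strict_mono[OF T, of y x] y(1) by (force simp: circle_def)
    then have "circle_dist x y * (1 + V (circle_dist x y / 2) / 2) \<le> lift V x + lift V 1 - lift V y"
      using lift_arc_expansion(2)[OF T, of x y] x01 y(1) by (simp add: circle_def)
    also have "\<dots> = \<bar>s\<bar>"
      using 1 y Fx D by (simp add: w_def)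
    finally show ?thesis
      using that[of y] y preimage d by auto
  next
    case 2
    then obtain y where y: "y \<in> circle" "lift V y = w"
      using lift_surj_on_circle[OF T, of w] D by auto
    have y01: "0 \<le> y" "y < 1"
      using y by (auto simp: circle_def)
    have "circle_dist x y * (1 + V (circle_dist x y / 2) / 2) \<le> \<bar>lift V y - lift V x\<bar>"
    proof (cases "x \<le> y")
      case True
      then show ?thesis
        using lift_arc_expansion(1)[OF T, of x y] x01 y01 by simp
    next
      case False
      then show ?thesis
        using lift_arc_expansion(1)[OF T, of y x] x01 y01 by (simp add: circle_dist_commute)
    qed
    also have "\<dots> = \<bar>s\<bar>"
      using y by (simp add: w_def)
    finally show ?thesis
      using that[of y] y preimage[of y 0] d by auto
  next
    case 3
    then obtain y where y: "y \<in> circle" "lift V y = w + of_int (- D)"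
      using lift_surj_on_circle[OF T, of "w - of_int D"] s1 Fx D by (auto simp: w_def)
    have "lift V y \<le> lift V x"
      using y s1 D by (simp add: w_def)
    then have "y \<le> x"
      using lift_strict_mono[OF T, of x y] x01 by force
    then have "circle_dist x y * (1 + V (circle_dist x y / 2) / 2) \<le> lift V y + lift V 1 - lift V x"
      using lift_arc_expansion(2)[OF T, of y x] x01 y(1) by (simp add: circle_def circle_dist_commute)
    also have "\<dots> = \<bar>s\<bar>"
      using 3 y Fx D by (simp add: w_def)
    finally show ?thesis
      using that[of y] y preimage[OF y] d by auto
  qed
qed

text \<open>
  Two distinct points with the same image cut the circle into two arcs, each of which is mapped
  around the circle a positive integer number of times.  By uniform continuity neither arc can be
  short.
\<close>

lemma locally_injective:
  assumes T: "in_family T V"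
  obtains \<delta> where "\<delta> > 0"
    "\<And>y z. y \<in> circle \<Longrightarrow> z \<in> circle \<Longrightarrow> T y = T z \<Longrightarrow> circle_dist y z < \<delta> \<Longrightarrow> y = z"
proof -
  obtain D where D: "D \<ge> 1" "lift V 1 = of_int D"
    by (rule lift_one[OF T])
  have "uniformly_continuous_on {0..1} (lift V)"
    by (intro compact_uniformly_continuous continuous_on_lift[OF T]) auto
  then obtain \<delta> where \<delta>: "\<delta> > 0"
    "\<And>a b. a \<in> {0..1} \<Longrightarrow> b \<in> {0..1} \<Longrightarrow> dist b a < \<delta> \<Longrightarrow> dist (lift V b) (lift V a) < 1 / 2"
    unfolding uniformly_continuous_on_def by (meson half_gt_zero zero_less_one)
  have close: "\<bar>lift V b - lift V a\<bar> < 1 / 2" if "0 \<le> a" "a \<le> b" "b \<le> 1" "b - a < \<delta>" for a b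
    using \<delta>(2)[of a b] that by (simp add: dist_real_def)
  have far: "\<delta> \<le> circle_dist y z" if yz: "y \<in> circle" "z \<in> circle" "T y = T z" "y < z" for y z
  proof (rule ccontr)
    assume "\<not> \<delta> \<le> circle_dist y z"
    then have d: "circle_dist y z < \<delta>" by simp
    have r: "0 \<le> y" "y < 1" "0 \<le> z" "z < 1"
      using yz by (auto simp: circle_def)
    define k where "k = \<lfloor>lift V z\<rfloor> - \<lfloor>lift V y\<rfloor>"
    have k: "lift V z - lift V y = of_int k"
      using yz in_family_eq_frac_lift[OF T] by (simp add: k_def frac_def)
    have "0 < lift V z - lift V y" "lift V z - lift V y < of_int D"
      using lift_strict_mono[OF T, of y z] lift_strict_mono[OF T, of z 1] lift_nonneg[OF T, of y]
        yz(4) r D by auto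
    then have kD: "1 \<le> k" "k \<le> D - 1"
      unfolding k by (simp_all flip: of_int_less_iff)
    have "circle_dist y z = \<bar>z - y\<bar> \<or> circle_dist y z = 1 - (z - y)"
      using yz(4) r by (auto simp: circle_dist_def min_def)
    then consider "z - y < \<delta>" | "1 - (z - y) < \<delta>"
      using d by force
    then show False
    proof cases
      case 1
      then show False
        using close[of y z] yz(4) r k kD by auto
    next
      case 2
      then have "\<bar>lift V y - lift V 0\<bar> < 1 / 2" "\<bar>lift V 1 - lift V z\<bar> < 1 / 2"
        using r close[of 0 y] close[of z 1] by linarith+
      moreover have "of_int k \<le> (of_int D :: real) - 1"
        using kD by linarith
      ultimately show False
        using k D by auto
    qed
  qed
  show ?thesis
  proof (rule that[OF \<delta>(1)])
    fix y z
    assume "y \<in> circle" "z \<in> circle" "T y = T z" "circle_dist y z < \<delta>"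
    then show "y = z"
      using far[of y z] far[of z y] by (cases y z rule: linorder_cases)
        (auto simp: circle_dist_commute[of z y])
  qed
qed

section \<open>The gain for the modulus of continuity\<close>

text \<open>
  Here \<open>h * (1 + V (h / 2) / 2)\<close> lies between \<open>h\<close> and \<open>(1 + c) * h\<close> once \<open>h\<close> is small, so concavity of
  \<open>\<Omega>\<close> along this segment applies.  A positive lower limit also rules out \<open>\<omega> h = 0\<close> for small \<open>h > 0\<close>,
  because division by zero gives zero.
\<close>

lemma modulus_gain:
  assumes T: "in_family T V" and \<omega>: "\<omega> \<in> concave_moduli" and \<Omega>: "\<Omega> \<in> concave_moduli"
    and c: "c > 0"
    and lim: "Liminf (at_right 0) (\<lambda>x. ereal (V x / \<omega> x * (\<Omega> ((1 + c) * x) - \<Omega> x))) > 0"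
  obtains \<delta> C where "\<delta> > 0" "C > 0"
    "\<And>h u. 0 \<le> h \<Longrightarrow> h < \<delta> \<Longrightarrow> h * (1 + V (h / 2) / 2) \<le> u \<Longrightarrow> \<Omega> h + C * \<omega> h \<le> \<Omega> u"
proof -
  obtain a where a: "a > 0"
    "\<forall>\<^sub>F h in at_right 0. a < V h / \<omega> h * (\<Omega> ((1 + c) * h) - \<Omega> h)"
  proof -
    obtain z where z: "0 < ereal z"
      "ereal z < Liminf (at_right 0) (\<lambda>x. ereal (V x / \<omega> x * (\<Omega> ((1 + c) * x) - \<Omega> x)))"
      using ereal_dense2[OF lim] by blast
    show ?thesis
      using z less_LiminfD[OF z(2)] by (intro that[of z]) auto
  qed
  obtain \<sigma> where "((\<lambda>x. V (1 / 2 * x) / V x) \<longlongrightarrow> (1 / 2) powr \<sigma>) (at_right 0)"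
    using T unfolding in_family_def by (metis half_gt_zero zero_less_one)
  moreover define b :: real where "b = (1 / 2) powr \<sigma> / 2"
  moreover have b: "b > 0" "b < (1 / 2) powr \<sigma>"
    by (simp_all add: b_def)
  ultimately have Vb: "\<forall>\<^sub>F h in at_right 0. b < V (1 / 2 * h) / V h"
    using order_tendstoD(1) by blast
  have V: "continuous_on {0..} V" "V 0 = 0"
    using T by (auto simp: in_family_def)
  from V(1) have "(V \<longlongrightarrow> V 0) (at 0 within {0..})"
    unfolding continuous_on_def by simp
  then have "(V \<longlongrightarrow> V 0) (at_right 0)"
    by (rule tendsto_within_subset) auto
  then have "\<forall>\<^sub>F h in at_right 0. V h < 2 * c"
    using c V(2) by (intro order_tendstoD(2)[of V 0]) simp_all
  with a(2) Vb have "\<forall>\<^sub>F h in at_right 0. a < V h / \<omega> h * (\<Omega> ((1 + c) * h) - \<Omega> h)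
      \<and> b < V (1 / 2 * h) / V h \<and> V h < 2 * c"
    by eventually_elim auto
  then obtain \<delta> where \<delta>: "\<delta> > 0"
    "\<And>h. 0 < h \<Longrightarrow> h < \<delta> \<Longrightarrow> a < V h / \<omega> h * (\<Omega> ((1 + c) * h) - \<Omega> h)
      \<and> b < V (1 / 2 * h) / V h \<and> V h < 2 * c"
    by (auto simp: eventually_at_right_field)
  \<comment> \<open>the product of the lower bounds \<open>a * \<omega> h / V h\<close> for the increment up to \<open>(1 + c) * h\<close> and
      \<open>b * V h / (2 * c)\<close> for the proportion of that increment which is used\<close>
  define C where "C = a * b / (2 * c)"
  have C: "C > 0"
    using a b c by (simp add: C_def)
  have mono: "mono_on {0..} \<Omega>" and conc: "concave_on {0..} \<Omega>" and \<Omega>0: "\<Omega> 0 = 0"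
    and \<Omega>nn: "\<And>x. 0 \<le> x \<Longrightarrow> 0 \<le> \<Omega> x"
    and \<omega>0: "\<omega> 0 = 0" and \<omega>nn: "\<And>x. 0 \<le> x \<Longrightarrow> 0 \<le> \<omega> x"
    using \<omega> \<Omega> by (auto simp: concave_moduli_def)
  have gain: "\<Omega> h + C * \<omega> h \<le> \<Omega> (h * (1 + V (h / 2) / 2))" if h: "0 < h" "h < \<delta>" for h
  proof -
    define v where "v = V (h / 2) / 2"
    define t where "t = v / c"
    have Vh: "0 < V h"
      using in_family_pos[OF T h(1)] .
    have 1: "a < V h / \<omega> h * (\<Omega> ((1 + c) * h) - \<Omega> h)" and 2: "b < V (h / 2) / V h"
      and 3: "V h < 2 * c"
      using \<delta>(2)[OF h] by auto
    have "\<omega> h \<noteq> 0"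
      using 1 a by auto
    then have \<omega>h: "0 < \<omega> h"
      using \<omega>nn[of h] h by simp
    have t: "0 \<le> t" "t \<le> 1"
      using in_family_mono[OF T, of "h / 2" h] in_family_nonneg[OF T, of "h / 2"] 3 h c
      by (auto simp: t_def v_def field_simps)
    have "a * \<omega> h / V h \<le> \<Omega> ((1 + c) * h) - \<Omega> h"
      using 1 Vh \<omega>h by (simp add: field_simps)
    moreover have "b * V h / (2 * c) \<le> t"
      using 2 Vh c by (simp add: t_def v_def field_simps)
    ultimately have "(b * V h / (2 * c)) * (a * \<omega> h / V h) \<le> t * (\<Omega> ((1 + c) * h) - \<Omega> h)"
      using a b c Vh \<omega>h t by (intro mult_mono) auto
    also have "(b * V h / (2 * c)) * (a * \<omega> h / V h) = C * \<omega> h"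
      using Vh by (simp add: C_def)
    also have "t * (\<Omega> ((1 + c) * h) - \<Omega> h) = ((1 - t) * \<Omega> h + t * \<Omega> ((1 + c) * h)) - \<Omega> h"
      by (simp add: algebra_simps)
    also have "(1 - t) * \<Omega> h + t * \<Omega> ((1 + c) * h) \<le> \<Omega> ((1 - t) * h + t * ((1 + c) * h))"
      using concave_onD[OF conc, of t h "(1 + c) * h"] t h c by simp
    also have "(1 - t) * h + t * ((1 + c) * h) = h * (1 + v)"
      using c by (simp add: t_def field_simps)
    finally show ?thesis
      by (simp add: v_def)
  qed
  show ?thesis
  proof (rule that[OF \<delta>(1) C])
    fix h u
    assume h: "0 \<le> h" "h < \<delta>" and u: "h * (1 + V (h / 2) / 2) \<le> u"
    have nn: "0 \<le> h * (1 + V (h / 2) / 2)"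
      using in_family_nonneg[OF T, of "h / 2"] h by simp
    show "\<Omega> h + C * \<omega> h \<le> \<Omega> u"
    proof (cases "h = 0")
      case True
      then show ?thesis
        using \<Omega>0 \<omega>0 \<Omega>nn[of u] u by simp
    next
      case False
      then have "\<Omega> h + C * \<omega> h \<le> \<Omega> (h * (1 + V (h / 2) / 2))"
        using gain h by simp
      also have "\<dots> \<le> \<Omega> u"
        using mono_onD[OF mono, of "h * (1 + V (h / 2) / 2)" u] nn u by simp
      finally show ?thesis .
    qed
  qed
qed

section \<open>The correspondence between pre-orbits\<close>

lemma controlled_commute: "controlled \<omega> \<Omega> \<rho> C x y = controlled \<omega> \<Omega> \<rho> C y x"
  by (simp add: controlled_def circle_dist_commute)

text \<open>
  Following inverse branches never increases the distance, so all distances stay in the range below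
  \<open>\<rho>\<close> where \<open>gain\<close> applies, and the gains of the single steps telescope.
\<close>

lemma controlled_preorbit_exists:
  assumes T: "in_family T V"
    and gain: "\<And>h u. 0 \<le> h \<Longrightarrow> h < \<rho> \<Longrightarrow> h * (1 + V (h / 2) / 2) \<le> u \<Longrightarrow> \<Omega> h + C * \<omega> h \<le> \<Omega> u"
    and x: "x \<in> preorbits T p" and q: "q \<in> circle" and d: "circle_dist p q < \<rho>"
  shows "\<exists>y. y \<in> preorbits T q \<and> controlled \<omega> \<Omega> \<rho> C x y"
proof -
  have x0: "x 0 = p" and xc: "\<And>k. x k \<in> circle" and xT: "\<And>k. T (x (Suc k)) = x k"
    using x by (auto simp: preorbits_def)
  let ?step = "\<lambda>n z z'. T z' = z \<and>
    circle_dist (x (Suc n)) z' * (1 + V (circle_dist (x (Suc n)) z' / 2) / 2) \<le> circle_dist (x n) z"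
  have "\<exists>y. \<forall>n. (y n \<in> circle \<and> (n = 0 \<longrightarrow> y n = q)) \<and> ?step n (y n) (y (Suc n))"
  proof (rule dependent_nat_choice)
    show "\<exists>z. z \<in> circle \<and> (0 = 0 \<longrightarrow> z = q)"
      using q by auto
  next
    fix z and n :: nat
    assume "z \<in> circle \<and> (n = 0 \<longrightarrow> z = q)"
    then obtain z' where "z' \<in> circle" "T z' = z"
      "circle_dist (x (Suc n)) z' * (1 + V (circle_dist (x (Suc n)) z' / 2) / 2)
        \<le> circle_dist (T (x (Suc n))) z"
      using inverse_branch_expansion[OF T xc[of "Suc n"], of z] by blast
    then show "\<exists>z'. (z' \<in> circle \<and> (Suc n = 0 \<longrightarrow> z' = q)) \<and> ?step n z z'"
      by (auto simp: xT)
  qed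
  then obtain y where yc: "\<And>n. y n \<in> circle" and y0: "y 0 = q" and yT: "\<And>n. T (y (Suc n)) = y n"
    and expand: "\<And>n. circle_dist (x (Suc n)) (y (Suc n))
        * (1 + V (circle_dist (x (Suc n)) (y (Suc n)) / 2) / 2) \<le> circle_dist (x n) (y n)"
    by metis
  define h where "h n = circle_dist (x n) (y n)" for n
  have h0: "0 \<le> h n" for n
    by (simp add: h_def)
  have step: "h (Suc n) * (1 + V (h (Suc n) / 2) / 2) \<le> h n" for n
    using expand by (simp add: h_def)
  have decr: "h (Suc n) \<le> h n" for n
  proof -
    have "h (Suc n) * 1 \<le> h (Suc n) * (1 + V (h (Suc n) / 2) / 2)"
      using h0 in_family_nonneg[OF T, of "h (Suc n) / 2"] by (intro mult_left_mono) auto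
    then show ?thesis
      using step[of n] by simp
  qed
  have le: "h n \<le> h 0" for n
    using decr by (rule lift_Suc_antimono_le) simp
  have \<rho>: "h 0 < \<rho>"
    using d by (simp add: h_def x0 y0)
  have sum: "\<Omega> (h k) + C * (\<Sum>j=1..k. \<omega> (h j)) \<le> \<Omega> (h 0)" for k
  proof (induction k)
    case (Suc k)
    have "\<Omega> (h (Suc k)) + C * \<omega> (h (Suc k)) \<le> \<Omega> (h k)"
      using h0 le[of "Suc k"] \<rho> step by (intro gain) auto
    then show ?case
      using Suc by (simp add: distrib_left)
  qed simp
  have "y \<in> preorbits T q"
    using yc y0 yT by (simp add: preorbits_def)
  moreover have "controlled \<omega> \<Omega> \<rho> C x y"
    using le \<rho> sum unfolding controlled_def by (auto simp: h_def)
  ultimately show ?thesis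
    by blast
qed

text \<open>
  At each step both candidates lie within \<open>\<rho>\<close> of the same point, hence within \<open>2 * \<rho>\<close> of each other,
  where \<open>T\<close> is injective.
\<close>

lemma controlled_preorbit_unique:
  assumes inj: "\<And>y z. y \<in> circle \<Longrightarrow> z \<in> circle \<Longrightarrow> T y = T z \<Longrightarrow> circle_dist y z < 2 * \<rho> \<Longrightarrow> y = z"
    and x: "x \<in> preorbits T p"
    and y: "y \<in> preorbits T q" "controlled \<omega> \<Omega> \<rho> C x y"
    and z: "z \<in> preorbits T q" "controlled \<omega> \<Omega> \<rho> C x z"
  shows "y = z"
proof
  fix k
  show "y k = z k"
  proof (induction k)
    case 0
    then show ?case
      using y z by (simp add: preorbits_def)
  next
    case (Suc k)
    have c: "x (Suc k) \<in> circle" "y (Suc k) \<in> circle" "z (Suc k) \<in> circle"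
      using x y z by (auto simp: preorbits_def)
    have "circle_dist (x (Suc k)) (y (Suc k)) < \<rho>"
      using y(2) unfolding controlled_def by (elim allE[of _ "Suc k"]) auto
    moreover have "circle_dist (x (Suc k)) (z (Suc k)) < \<rho>"
      using z(2) unfolding controlled_def by (elim allE[of _ "Suc k"]) auto
    ultimately have "circle_dist (y (Suc k)) (z (Suc k)) < 2 * \<rho>"
      using circle.triangle[OF c(2) c(1) c(3)] circle_dist_commute[of "y (Suc k)"] by simp
    moreover have "T (y (Suc k)) = T (z (Suc k))"
      using y z Suc by (simp add: preorbits_def)
    ultimately show ?case
      using inj c by blast
  qed
qed

text \<open>
  When a relation is functional in both directions, the two choice functions are mutually inverse.
\<close>

lemma bij_betw_the_if_ex1:
  assumes AB: "\<And>x. x \<in> A \<Longrightarrow> \<exists>!y. y \<in> B \<and> R x y" and BA: "\<And>y. y \<in> B \<Longrightarrow> \<exists>!x. x \<in> A \<and> R x y"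
  shows "bij_betw (\<lambda>x. THE y. y \<in> B \<and> R x y) A B"
proof (rule bij_betw_byWitness[where f' = "\<lambda>y. THE x. x \<in> A \<and> R x y"])
  note f = theI'[OF AB] and g = theI'[OF BA]
  show "\<forall>x\<in>A. (THE x'. x' \<in> A \<and> R x' (THE y. y \<in> B \<and> R x y)) = x"
    using f BA by (intro ballI the1_equality) auto
  show "\<forall>y\<in>B. (THE y'. y' \<in> B \<and> R (THE x. x \<in> A \<and> R x y) y') = y"
    using g AB by (intro ballI the1_equality) auto
  show "(\<lambda>x. THE y. y \<in> B \<and> R x y) ` A \<subseteq> B"
    using f by auto
  show "(\<lambda>y. THE x. x \<in> A \<and> R x y) ` B \<subseteq> A"
    using g by auto
qed

theorem proposition7:
  fixes T V \<omega> \<Omega> :: "real \<Rightarrow> real"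
  assumes "in_family T V"
    and "\<omega> \<in> concave_moduli" and "\<Omega> \<in> concave_moduli"
    and "\<forall>\<^sub>F c in at_right 0.
      Liminf (at_right 0) (\<lambda>x. ereal (V x / \<omega> x * (\<Omega> ((1 + c) * x) - \<Omega> x))) > 0"
  shows "compatible T \<omega> \<Omega>"
proof -
  note T = assms(1)
  have "\<forall>\<^sub>F c in at_right (0 :: real). c > 0"
    by (simp add: eventually_at_right_less)
  with assms(4) have "\<forall>\<^sub>F c in at_right 0. c > 0 \<and>
      Liminf (at_right 0) (\<lambda>x. ereal (V x / \<omega> x * (\<Omega> ((1 + c) * x) - \<Omega> x))) > 0"
    by eventually_elim auto
  then obtain c where c: "c > 0"
    "Liminf (at_right 0) (\<lambda>x. ereal (V x / \<omega> x * (\<Omega> ((1 + c) * x) - \<Omega> x))) > 0"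
    using eventually_happens'[OF trivial_limit_at_right_real] by blast
  obtain \<delta> C where \<delta>: "\<delta> > 0" and C: "C > 0"
    and gain: "\<And>h u. 0 \<le> h \<Longrightarrow> h < \<delta> \<Longrightarrow> h * (1 + V (h / 2) / 2) \<le> u \<Longrightarrow> \<Omega> h + C * \<omega> h \<le> \<Omega> u"
    using modulus_gain[OF T assms(2,3) c] by blast
  obtain \<epsilon> where \<epsilon>: "\<epsilon> > 0"
    and inj: "\<And>y z. y \<in> circle \<Longrightarrow> z \<in> circle \<Longrightarrow> T y = T z \<Longrightarrow> circle_dist y z < \<epsilon> \<Longrightarrow> y = z"
    using locally_injective[OF T] by blast
  define \<rho> where "\<rho> = min \<delta> (\<epsilon> / 2)"
  have \<rho>: "\<rho> > 0" "\<rho> \<le> \<delta>" "2 * \<rho> \<le> \<epsilon>"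
    using \<delta> \<epsilon> by (auto simp: \<rho>_def)
  have gain': "\<Omega> h + C * \<omega> h \<le> \<Omega> u"
    if "0 \<le> h" "h < \<rho>" "h * (1 + V (h / 2) / 2) \<le> u" for h u
    using gain that \<rho> by simp
  have inj': "y = z" if "y \<in> circle" "z \<in> circle" "T y = T z" "circle_dist y z < 2 * \<rho>" for y z
    using inj that \<rho> by simp
  have ex1: "\<exists>!y. y \<in> preorbits T q \<and> controlled \<omega> \<Omega> \<rho> C x y"
    if "q \<in> circle" "circle_dist p q < \<rho>" "x \<in> preorbits T p" for p q x
    using controlled_preorbit_exists[where \<omega> = \<omega>, OF T gain' that(3,1,2)]
      controlled_preorbit_unique[where T = T, OF inj' that(3)] by blast
  have "bij_betw (\<lambda>x. THE y. y \<in> preorbits T q \<and> controlled \<omega> \<Omega> \<rho> C x y)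
      (preorbits T p) (preorbits T q)"
    if pq: "p \<in> circle" "q \<in> circle" "circle_dist p q < \<rho>" for p q
  proof (rule bij_betw_the_if_ex1)
    show "\<exists>!y. y \<in> preorbits T q \<and> controlled \<omega> \<Omega> \<rho> C x y" if "x \<in> preorbits T p" for x
      using ex1 pq that by blast
    show "\<exists>!x. x \<in> preorbits T p \<and> controlled \<omega> \<Omega> \<rho> C x y" if "y \<in> preorbits T q" for y
      using ex1[of p q y] pq that by (simp add: circle_dist_commute controlled_commute)
  qed
  then show ?thesis
    unfolding compatible_def using \<rho>(1) C ex1
    by (intro exI[of _ \<rho>] exI[of _ C] conjI ballI impI) simp_all
qed

end
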